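(* Let $X,Y$ be real Banach spaces. Suppose $X^*$ has $w^*$-$BDP$ and $Y^*$ has $w^*$-$BSCSP$. Then $(X\hat{\otimes}_{\varepsilon}Y)^*$ has $w^*$-$BSCSP$.
   Context: All Banach spaces are real; $B_Z$, $S_Z$ denote the closed unit ball and unit sphere of $Z$. $X\hat{\otimes}_{\varepsilon}Y$ is the injective tensor product: the completion of the algebraic tensor product $X\otimes Y$ under $\|\sum_{i=1}^n x_i\otimes y_i\|_{\varepsilon}=\sup\{|\sum_{i=1}^n x^*(x_i)y^*(y_i)| : x^*\in S_{X^*},\,y^*\in S_{Y^*}\}$. A $w^*$-slice of $B_{Z^*}$ is a set $\{f\in B_{Z^*}: f(z)>1-\alpha\}$ with $z\in S_Z$, $0<\alpha<1$. $Z^*$ has $w^*$-$BDP$ ($w^*$-Ball Dentable Property) if $B_{Z^*}$ has $w^*$-slices of arbitrarily small diameter. $Z^*$ has $w^*$-$BSCSP$ ($w^*$-Ball Small Combination of Slice Property) if for every $\varepsilon>0$ there are $w^*$-slices $S_1,\dots,S_n$ of $B_{Z^*}$ and $\lambda_i\ge 0$ with $\sum_{i=1}^n\lambda_i=1$ such that $\sum_{i=1}^n\lambda_iS_i=\{\sum_{i=1}^n\lambda_if_i: f_i\in S_i\}$ has diameter less than $\varepsilon$. The preduals used for $X^*$, $Y^*$, $(X\hat{\otimes}_{\varepsilon}Y)^*$ are $X$, $Y$, $X\hat{\otimes}_{\varepsilon}Y$. *)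

theory Defs
  imports "HOL-Analysis.Analysis"
begin

section \<open>The algebraic tensor product\<close>

text \<open>
  A list \<open>[(x\<^sub>1,y\<^sub>1),\<dots>,(x\<^sub>n,y\<^sub>n)]\<close> stands for the formal sum of the \<open>x\<^sub>i \<otimes> y\<^sub>i\<close>.  As in the usual
  construction of \<open>X \<otimes> Y\<close> inside the algebraic dual of the space of bilinear forms on
  \<open>X \<times> Y\<close>, two formal sums are the same tensor iff no (not necessarily bounded) bilinear
  form separates them.
\<close>

definition eval_sum :: "('a \<Rightarrow> 'b \<Rightarrow> real) \<Rightarrow> ('a \<times> 'b) list \<Rightarrow> real" where
  "eval_sum B ps = (\<Sum>(x, y)\<leftarrow>ps. B x y)"

definition tensor_eq ::
    "('a::real_vector \<times> 'b::real_vector) list \<Rightarrow> ('a \<times> 'b) list \<Rightarrow> bool" where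
  "tensor_eq ps qs \<longleftrightarrow> (\<forall>B. bilinear B \<longrightarrow> eval_sum B ps = eval_sum B qs)"

lemma eval_sum_Nil [simp]: "eval_sum B [] = 0"
  by (simp add: eval_sum_def)

lemma eval_sum_Cons [simp]: "eval_sum B ((x, y) # ps) = B x y + eval_sum B ps"
  by (simp add: eval_sum_def)

lemma eval_sum_append [simp]: "eval_sum B (ps @ qs) = eval_sum B ps + eval_sum B qs"
  by (simp add: eval_sum_def)

lemma eval_sum_scale:
  assumes "bilinear B"
  shows "eval_sum B (map (\<lambda>(x, y). (c *\<^sub>R x, y)) ps) = c * eval_sum B ps"
  by (induction ps) (auto simp: bilinear_lmul[OF assms] algebra_simps)

quotient_type (overloaded) ('a, 'b) alg_tensor =
    "('a::real_vector \<times> 'b::real_vector) list" / tensor_eq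
  by (rule equivpI) (auto simp: reflp_def symp_def transp_def tensor_eq_def)

instantiation alg_tensor :: (real_vector, real_vector) real_vector
begin

lift_definition zero_alg_tensor :: "('a, 'b) alg_tensor" is "[]" .

lift_definition plus_alg_tensor ::
    "('a, 'b) alg_tensor \<Rightarrow> ('a, 'b) alg_tensor \<Rightarrow> ('a, 'b) alg_tensor" is "(@)"
  by (auto simp: tensor_eq_def)

lift_definition scaleR_alg_tensor ::
    "real \<Rightarrow> ('a, 'b) alg_tensor \<Rightarrow> ('a, 'b) alg_tensor"
  is "\<lambda>c. map (\<lambda>(x, y). (c *\<^sub>R x, y))"
  by (auto simp: tensor_eq_def eval_sum_scale)

definition uminus_alg_tensor :: "('a, 'b) alg_tensor \<Rightarrow> ('a, 'b) alg_tensor" where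
  "- t = (- 1) *\<^sub>R (t :: ('a, 'b) alg_tensor)"

definition minus_alg_tensor ::
    "('a, 'b) alg_tensor \<Rightarrow> ('a, 'b) alg_tensor \<Rightarrow> ('a, 'b) alg_tensor" where
  "s - t = s + - (t :: ('a, 'b) alg_tensor)"

instance
proof
  fix a b c :: "('a, 'b) alg_tensor" and r s :: real
  show "a + b + c = a + (b + c)" by transfer (simp add: tensor_eq_def)
  show "a + b = b + a" by transfer (simp add: tensor_eq_def)
  show "0 + a = a" by transfer (simp add: tensor_eq_def)
  show "- a + a = 0" unfolding uminus_alg_tensor_def
    by transfer (simp add: tensor_eq_def eval_sum_scale[where c = "- 1", simplified])
  show "a - b = a + - b" by (simp add: minus_alg_tensor_def)
  show "r *\<^sub>R (a + b) = r *\<^sub>R a + r *\<^sub>R b"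
    by transfer (simp add: tensor_eq_def eval_sum_scale algebra_simps)
  show "(r + s) *\<^sub>R a = r *\<^sub>R a + s *\<^sub>R a"
    by transfer (auto simp only: tensor_eq_def eval_sum_append eval_sum_scale distrib_right)
  show "r *\<^sub>R s *\<^sub>R a = (r * s) *\<^sub>R a"
    by transfer (auto simp only: tensor_eq_def eval_sum_scale mult.assoc)
  show "1 *\<^sub>R a = a"
    by transfer (simp add: tensor_eq_def eval_sum_scale)
qed

end

lift_definition tensor :: "'a::real_vector \<Rightarrow> 'b::real_vector \<Rightarrow> ('a, 'b) alg_tensor"
  is "\<lambda>x y. [(x, y)]" .

lemma bilinear_tensor: "bilinear tensor"
  unfolding bilinear_def
proof (intro conjI allI linearI)
  fix x x' :: 'a and y y' :: 'b and r :: real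
  show "tensor x (y + y') = tensor x y + tensor x y'"
    by transfer (simp add: tensor_eq_def bilinear_radd)
  show "tensor x (r *\<^sub>R y) = r *\<^sub>R tensor x y"
    by transfer (simp add: tensor_eq_def bilinear_rmul bilinear_lmul)
  show "tensor (x + x') y = tensor x y + tensor x' y"
    by transfer (simp add: tensor_eq_def bilinear_ladd)
  show "tensor (r *\<^sub>R x) y = r *\<^sub>R tensor x y"
    by transfer (simp add: tensor_eq_def)
qed

lemma alg_tensor_eq_sum: "\<exists>ps. t = (\<Sum>(x, y)\<leftarrow>ps. tensor x y)"
proof (rule exI[of _ "rep_alg_tensor t"])
  have "abs_alg_tensor ps = (\<Sum>(x, y)\<leftarrow>ps. tensor x y)" for ps :: "('a \<times> 'b) list"
  proof (induction ps)
    case Nil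
    then show ?case by (simp add: zero_alg_tensor_def)
  next
    case (Cons p ps)
    obtain x y where p: "p = (x, y)" by (cases p)
    have "abs_alg_tensor (p # ps) = tensor x y + abs_alg_tensor ps"
      by (simp add: p tensor_def plus_alg_tensor.abs_eq)
    then show ?case by (simp add: Cons.IH p)
  qed
  then show "t = (\<Sum>(x, y)\<leftarrow>rep_alg_tensor t. tensor x y)"
    by (metis Quotient_alg_tensor Quotient_abs_rep)
qed

lemma alg_tensor_universal:
  fixes B :: "'a::real_vector \<Rightarrow> 'b::real_vector \<Rightarrow> 'c::real_vector"
  assumes B: "bilinear B"
  shows "\<exists>!L. linear L \<and> (\<forall>x y. L (tensor x y) = B x y)"
proof (rule ex_ex1I)
  define S where "S ps = (\<Sum>(x, y)\<leftarrow>ps. B x y)" for ps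
  define L where "L t = S (rep_alg_tensor t)" for t
  have S_eq: "S ps = S qs" if eq: "tensor_eq ps qs" for ps qs
  proof (rule ccontr)
    assume "S ps \<noteq> S qs"
    then have "independent {S ps - S qs}" by simp
    from linear_independent_extend[OF this, of "\<lambda>_. 1 :: real"]
    obtain h :: "'c \<Rightarrow> real" where h: "linear h" "h (S ps - S qs) = 1" by auto
    have "bilinear (\<lambda>x y. h (B x y))"
      using B h(1) unfolding bilinear_def by (auto intro: linear_compose[unfolded o_def])
    then have "eval_sum (\<lambda>x y. h (B x y)) ps = eval_sum (\<lambda>x y. h (B x y)) qs"
      using eq by (simp add: tensor_eq_def)
    moreover have "eval_sum (\<lambda>x y. h (B x y)) rs = h (S rs)" for rs
      by (induction rs) (auto simp: S_def linear_0[OF h(1)] linear_add[OF h(1)])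
    ultimately show False using h by (simp add: linear_diff)
  qed
  have L_abs: "L (abs_alg_tensor ps) = S ps" for ps
    unfolding L_def
  proof (rule S_eq)
    show "tensor_eq (rep_alg_tensor (abs_alg_tensor ps)) ps"
      using Quotient_abs_rep[OF Quotient_alg_tensor, of "abs_alg_tensor ps"]
      by (simp only: alg_tensor.abs_eq_iff)
  qed
  have S_scale: "S (map (\<lambda>(x, y). (c *\<^sub>R x, y)) ps) = c *\<^sub>R S ps" for c ps
    by (induction ps) (auto simp: S_def bilinear_lmul[OF B] scaleR_add_right)
  have "linear L"
  proof (rule linearI)
    fix s t :: "('a, 'b) alg_tensor" and c :: real
    obtain ps qs where "s = abs_alg_tensor ps" "t = abs_alg_tensor qs"
      using Quotient_abs_rep[OF Quotient_alg_tensor] by metis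
    then show "L (s + t) = L s + L t" "L (c *\<^sub>R s) = c *\<^sub>R L s"
      by (simp_all add: plus_alg_tensor.abs_eq scaleR_alg_tensor.abs_eq L_abs S_scale)
        (simp add: S_def)
  qed
  moreover have "L (tensor x y) = B x y" for x y
    by (simp add: tensor_def L_abs S_def)
  ultimately show "\<exists>L. linear L \<and> (\<forall>x y. L (tensor x y) = B x y)" by blast
next
  fix L L' :: "('a, 'b) alg_tensor \<Rightarrow> 'c"
  assume L: "linear L \<and> (\<forall>x y. L (tensor x y) = B x y)"
    and L': "linear L' \<and> (\<forall>x y. L' (tensor x y) = B x y)"
  have "L (\<Sum>(x, y)\<leftarrow>ps. tensor x y) = L' (\<Sum>(x, y)\<leftarrow>ps. tensor x y)" for ps
    using L L' by (induction ps) (auto simp: linear_0 linear_add)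
  then show "L = L'" using alg_tensor_eq_sum by (metis ext)
qed


section \<open>The injective norm\<close>

lemma bilinear_functionals:
  fixes f :: "'a::real_normed_vector \<Rightarrow>\<^sub>L real" and g :: "'b::real_normed_vector \<Rightarrow>\<^sub>L real"
  shows "bilinear (\<lambda>x y. f x * g y)"
  by (auto simp: bilinear_def blinfun.add_right blinfun.scaleR_right algebra_simps
      intro!: linearI)

text \<open>\<open>eval_tensor f g (\<Sum> x\<^sub>i \<otimes> y\<^sub>i) = \<Sum> f(x\<^sub>i) g(y\<^sub>i)\<close>.\<close>

lift_definition eval_tensor ::
    "('a::real_normed_vector \<Rightarrow>\<^sub>L real) \<Rightarrow> ('b::real_normed_vector \<Rightarrow>\<^sub>L real) \<Rightarrow>
     ('a, 'b) alg_tensor \<Rightarrow> real"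
  is "\<lambda>f g. eval_sum (\<lambda>x y. blinfun_apply f x * blinfun_apply g y)"
  by (simp add: tensor_eq_def bilinear_functionals)

text \<open>The element \<open>0\<close> only matters when \<open>X\<close> or \<open>Y\<close> is trivial, so that a dual sphere is
  empty: the supremum of the empty set is then \<open>0\<close>.\<close>

definition inj_norm_set ::
    "('a::real_normed_vector, 'b::real_normed_vector) alg_tensor \<Rightarrow> real set" where
  "inj_norm_set t =
     insert 0 {\<bar>eval_tensor f g t\<bar> | f g. f \<in> sphere 0 1 \<and> g \<in> sphere 0 1}"

definition inj_norm ::
    "('a::real_normed_vector, 'b::real_normed_vector) alg_tensor \<Rightarrow> real" where
  "inj_norm t = Sup (inj_norm_set t)"

lemma eval_tensor_tensor [simp]: "eval_tensor f g (tensor x y) = f x * g y"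
  by (simp add: tensor_def eval_tensor.abs_eq)

lemma eval_tensor_0 [simp]: "eval_tensor f g 0 = 0"
  by transfer simp

lemma eval_tensor_add: "eval_tensor f g (s + t) = eval_tensor f g s + eval_tensor f g t"
  by transfer simp

lemma eval_tensor_scaleR: "eval_tensor f g (c *\<^sub>R t) = c * eval_tensor f g t"
  by transfer (simp add: eval_sum_scale bilinear_functionals)

lemma eval_tensor_sum_list:
  "eval_tensor f g (\<Sum>(x, y)\<leftarrow>ps. tensor x y) = (\<Sum>(x, y)\<leftarrow>ps. f x * g y)"
  by (induction ps) (auto simp: eval_tensor_add)

lemma bdd_above_inj_norm_set: "bdd_above (inj_norm_set t)"
proof -
  obtain ps where t: "t = (\<Sum>(x, y)\<leftarrow>ps. tensor x y)"
    using alg_tensor_eq_sum by blast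
  have "\<bar>\<Sum>(x, y)\<leftarrow>ps. blinfun_apply f x * blinfun_apply g y\<bar> \<le> (\<Sum>(x, y)\<leftarrow>ps. norm x * norm y)"
    if f: "norm f = 1" and g: "norm g = 1" for f :: "'a \<Rightarrow>\<^sub>L real" and g :: "'b \<Rightarrow>\<^sub>L real"
  proof (induction ps)
    case (Cons p ps)
    obtain x y where p: "p = (x, y)" by (cases p)
    have "\<bar>f x * g y\<bar> \<le> norm x * norm y"
      using norm_blinfun[of f x] norm_blinfun[of g y] f g
      by (auto simp: abs_mult intro!: mult_mono)
    with Cons show ?case by (simp add: p)
  qed simp
  moreover have "0 \<le> (\<Sum>(x, y)\<leftarrow>ps. norm x * norm y)"
    by (rule sum_list_nonneg) auto
  ultimately show ?thesis
    by (intro bdd_aboveI[of _ "\<Sum>(x, y)\<leftarrow>ps. norm x * norm y"])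
      (auto simp: inj_norm_set_def t eval_tensor_sum_list)
qed

lemma inj_norm_nonneg: "0 \<le> inj_norm t"
  unfolding inj_norm_def
  by (rule cSup_upper[OF _ bdd_above_inj_norm_set]) (simp add: inj_norm_set_def)

lemma inj_norm_upper:
  assumes "norm f = 1" "norm g = 1"
  shows "\<bar>eval_tensor f g t\<bar> \<le> inj_norm t"
  unfolding inj_norm_def
  by (rule cSup_upper[OF _ bdd_above_inj_norm_set]) (use assms in \<open>auto simp: inj_norm_set_def\<close>)

lemma inj_norm_least:
  assumes "0 \<le> c" "\<And>f g. norm f = 1 \<Longrightarrow> norm g = 1 \<Longrightarrow> \<bar>eval_tensor f g t\<bar> \<le> c"
  shows "inj_norm t \<le> c"
  unfolding inj_norm_def
  by (rule cSup_least) (use assms in \<open>auto simp: inj_norm_set_def\<close>)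

lemma inj_norm_0 [simp]: "inj_norm 0 = 0"
  by (rule antisym[OF inj_norm_least inj_norm_nonneg]) auto

lemma inj_norm_triangle: "inj_norm (s + t) \<le> inj_norm s + inj_norm t"
proof (rule inj_norm_least)
  show "0 \<le> inj_norm s + inj_norm t" by (simp add: inj_norm_nonneg)
  fix f :: "'a \<Rightarrow>\<^sub>L real" and g :: "'b \<Rightarrow>\<^sub>L real"
  assume "norm f = 1" "norm g = 1"
  from inj_norm_upper[OF this, of s] inj_norm_upper[OF this, of t]
  show "\<bar>eval_tensor f g (s + t)\<bar> \<le> inj_norm s + inj_norm t"
    by (simp add: eval_tensor_add)
qed

lemma inj_norm_scaleR_le: "inj_norm (c *\<^sub>R t) \<le> \<bar>c\<bar> * inj_norm t"
  by (rule inj_norm_least)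
    (auto simp: inj_norm_nonneg eval_tensor_scaleR abs_mult inj_norm_upper intro!: mult_left_mono)

lemma inj_norm_scaleR: "inj_norm (c *\<^sub>R t) = \<bar>c\<bar> * inj_norm t"
proof (cases "c = 0")
  case False
  have "inj_norm t = inj_norm (inverse c *\<^sub>R (c *\<^sub>R t))" using False by simp
  also have "\<dots> \<le> \<bar>inverse c\<bar> * inj_norm (c *\<^sub>R t)" by (rule inj_norm_scaleR_le)
  finally have "\<bar>c\<bar> * inj_norm t \<le> inj_norm (c *\<^sub>R t)"
    using False by (simp add: field_simps)
  with inj_norm_scaleR_le[of c t] show ?thesis by simp
qed simp

lemma inj_norm_uminus: "inj_norm (- t) = inj_norm t"
  using inj_norm_scaleR[of "- 1" t] by simp

lemma inj_norm_minus_commute: "inj_norm (s - t) = inj_norm (t - s)"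
  using inj_norm_uminus[of "s - t"] by simp

lemma inj_norm_diff_triangle: "inj_norm (s - u) \<le> inj_norm (s - t) + inj_norm (t - u)"
  using inj_norm_triangle[of "s - t" "t - u"] by simp

lemma inj_norm_diff_add:
  "inj_norm (s + t - (s' + t')) \<le> inj_norm (s - s') + inj_norm (t - t')"
  using inj_norm_triangle[of "s - s'" "t - t'"] by (simp add: algebra_simps)

lemma abs_inj_norm_diff: "\<bar>inj_norm s - inj_norm t\<bar> \<le> inj_norm (s - t)"
  using inj_norm_triangle[of "s - t" t] inj_norm_triangle[of "t - s" s]
    inj_norm_minus_commute[of s t] by simp


section \<open>The injective tensor product\<close>

text \<open>The completion of the algebraic tensor product: Cauchy sequences with respect to the
  injective norm, modulo null sequences.  (That \<open>inj_norm\<close> vanishes only at \<open>0\<close>, by Hahn-Banach,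
  is not needed for the construction.)\<close>

definition inj_Cauchy ::
    "(nat \<Rightarrow> ('a::real_normed_vector, 'b::real_normed_vector) alg_tensor) \<Rightarrow> bool" where
  "inj_Cauchy u \<longleftrightarrow> (\<forall>e>0. \<exists>N. \<forall>m\<ge>N. \<forall>n\<ge>N. inj_norm (u m - u n) < e)"

definition inj_equiv ::
    "(nat \<Rightarrow> ('a::real_normed_vector, 'b::real_normed_vector) alg_tensor) \<Rightarrow>
     (nat \<Rightarrow> ('a, 'b) alg_tensor) \<Rightarrow> bool" where
  "inj_equiv u v \<longleftrightarrow> inj_Cauchy u \<and> inj_Cauchy v \<and> (\<lambda>n. inj_norm (u n - v n)) \<longlonglongrightarrow> 0"

lemma inj_Cauchy_const: "inj_Cauchy (\<lambda>_. t)"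
  by (simp add: inj_Cauchy_def)

lemma inj_Cauchy_add:
  assumes "inj_Cauchy u" "inj_Cauchy v"
  shows "inj_Cauchy (\<lambda>n. u n + v n)"
  unfolding inj_Cauchy_def
proof (intro allI impI)
  fix e :: real assume "0 < e"
  then have e: "0 < e / 2" by simp
  from assms(1) e obtain M where M: "\<And>m n. m \<ge> M \<Longrightarrow> n \<ge> M \<Longrightarrow> inj_norm (u m - u n) < e / 2"
    unfolding inj_Cauchy_def by blast
  from assms(2) e obtain N where N: "\<And>m n. m \<ge> N \<Longrightarrow> n \<ge> N \<Longrightarrow> inj_norm (v m - v n) < e / 2"
    unfolding inj_Cauchy_def by blast
  have "inj_norm (u m + v m - (u n + v n)) < e" if "m \<ge> max M N" "n \<ge> max M N" for m n
    using inj_norm_diff_add[of "u m" "v m" "u n" "v n"] M[of m n] N[of m n] that by simp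
  then show "\<exists>N. \<forall>m\<ge>N. \<forall>n\<ge>N. inj_norm (u m + v m - (u n + v n)) < e" by blast
qed

lemma inj_Cauchy_scaleR:
  assumes "inj_Cauchy u"
  shows "inj_Cauchy (\<lambda>n. c *\<^sub>R u n)"
  unfolding inj_Cauchy_def
proof (intro allI impI)
  fix e :: real assume "0 < e"
  then have "0 < e / (\<bar>c\<bar> + 1)" by simp
  with assms obtain N
    where N: "\<And>m n. m \<ge> N \<Longrightarrow> n \<ge> N \<Longrightarrow> inj_norm (u m - u n) < e / (\<bar>c\<bar> + 1)"
    unfolding inj_Cauchy_def by blast
  have "inj_norm (c *\<^sub>R u m - c *\<^sub>R u n) < e" if "m \<ge> N" "n \<ge> N" for m n
  proof -
    have "inj_norm (c *\<^sub>R u m - c *\<^sub>R u n) = \<bar>c\<bar> * inj_norm (u m - u n)"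
      by (simp add: inj_norm_scaleR flip: scaleR_diff_right)
    also have "\<dots> \<le> (\<bar>c\<bar> + 1) * inj_norm (u m - u n)"
      by (intro mult_right_mono) (auto simp: inj_norm_nonneg)
    also have "\<dots> < e" using N[OF that] by (simp add: field_simps)
    finally show ?thesis .
  qed
  then show "\<exists>N. \<forall>m\<ge>N. \<forall>n\<ge>N. inj_norm (c *\<^sub>R u m - c *\<^sub>R u n) < e" by blast
qed

lemma inj_equiv_refl_iff: "inj_equiv u u \<longleftrightarrow> inj_Cauchy u"
  by (simp add: inj_equiv_def)

lemma tendsto_0_inj_norm_le:
  assumes "f \<longlonglongrightarrow> 0" "\<And>n. inj_norm (u n) \<le> f n"
  shows "(\<lambda>n. inj_norm (u n)) \<longlonglongrightarrow> 0"
  by (rule tendsto_sandwich[OF _ _ tendsto_const assms(1)])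
    (auto simp: assms(2) inj_norm_nonneg)

lemma part_equivp_inj_equiv:
  "part_equivp (inj_equiv ::
     (nat \<Rightarrow> ('a::real_normed_vector, 'b::real_normed_vector) alg_tensor) \<Rightarrow> _)"
  (is "part_equivp ?R")
proof (rule part_equivpI)
  show "\<exists>u. ?R u u" using inj_Cauchy_const inj_equiv_refl_iff by blast
  show "symp ?R"
    by (rule sympI) (auto simp: inj_equiv_def inj_norm_minus_commute)
  show "transp ?R"
  proof (rule transpI)
    fix u v w :: "nat \<Rightarrow> ('a, 'b) alg_tensor"
    assume *: "inj_equiv u v" "inj_equiv v w"
    then have "(\<lambda>n. inj_norm (u n - v n) + inj_norm (v n - w n)) \<longlonglongrightarrow> 0 + 0"
      unfolding inj_equiv_def by (intro tendsto_add) auto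
    then have "(\<lambda>n. inj_norm (u n - w n)) \<longlonglongrightarrow> 0"
      by (intro tendsto_0_inj_norm_le[where u = "\<lambda>n. u n - w n"])
        (auto simp: inj_norm_diff_triangle)
    with * show "inj_equiv u w" by (simp add: inj_equiv_def)
  qed
qed

quotient_type (overloaded) ('a, 'b) inj_tensor =
    "nat \<Rightarrow> ('a::real_normed_vector, 'b::real_normed_vector) alg_tensor" / partial: inj_equiv
  by (rule part_equivp_inj_equiv)

lemma inj_Cauchy_imp_Cauchy_norm:
  assumes "inj_Cauchy u"
  shows "Cauchy (\<lambda>n. inj_norm (u n))"
proof (rule metric_CauchyI)
  fix e :: real assume "0 < e"
  with assms obtain N where N: "\<And>m n. m \<ge> N \<Longrightarrow> n \<ge> N \<Longrightarrow> inj_norm (u m - u n) < e"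
    unfolding inj_Cauchy_def by blast
  have "dist (inj_norm (u m)) (inj_norm (u n)) < e" if "m \<ge> N" "n \<ge> N" for m n
    using N[OF that] abs_inj_norm_diff[of "u m" "u n"] by (simp add: dist_real_def)
  then show "\<exists>M. \<forall>m\<ge>M. \<forall>n\<ge>M. dist (inj_norm (u m)) (inj_norm (u n)) < e" by blast
qed

lemma inj_Cauchy_norm_tendsto:
  assumes "inj_Cauchy u"
  shows "(\<lambda>n. inj_norm (u n)) \<longlonglongrightarrow> lim (\<lambda>n. inj_norm (u n))"
  using inj_Cauchy_imp_Cauchy_norm[OF assms] by (simp add: Cauchy_convergent_iff convergent_LIMSEQ_iff)

instantiation inj_tensor :: (real_normed_vector, real_normed_vector) real_normed_vector
begin

lift_definition zero_inj_tensor :: "('a, 'b) inj_tensor" is "\<lambda>_. 0"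
  by (simp add: inj_equiv_refl_iff inj_Cauchy_const)

lift_definition plus_inj_tensor ::
    "('a, 'b) inj_tensor \<Rightarrow> ('a, 'b) inj_tensor \<Rightarrow> ('a, 'b) inj_tensor"
  is "\<lambda>u v n. u n + v n"
proof -
  fix u u' v v' :: "nat \<Rightarrow> ('a, 'b) alg_tensor"
  assume *: "inj_equiv u u'" "inj_equiv v v'"
  then have "(\<lambda>n. inj_norm (u n - u' n) + inj_norm (v n - v' n)) \<longlonglongrightarrow> 0 + 0"
    unfolding inj_equiv_def by (intro tendsto_add) auto
  then have "(\<lambda>n. inj_norm (u n + v n - (u' n + v' n))) \<longlonglongrightarrow> 0"
    by (intro tendsto_0_inj_norm_le[where u = "\<lambda>n. u n + v n - (u' n + v' n)"])
      (auto simp: inj_norm_diff_add)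
  with * show "inj_equiv (\<lambda>n. u n + v n) (\<lambda>n. u' n + v' n)"
    by (simp add: inj_equiv_def inj_Cauchy_add)
qed

lift_definition scaleR_inj_tensor ::
    "real \<Rightarrow> ('a, 'b) inj_tensor \<Rightarrow> ('a, 'b) inj_tensor"
  is "\<lambda>c u n. c *\<^sub>R u n"
proof -
  fix c :: real and u v :: "nat \<Rightarrow> ('a, 'b) alg_tensor"
  assume *: "inj_equiv u v"
  then have "(\<lambda>n. \<bar>c\<bar> * inj_norm (u n - v n)) \<longlonglongrightarrow> \<bar>c\<bar> * 0"
    unfolding inj_equiv_def by (intro tendsto_mult) auto
  with * show "inj_equiv (\<lambda>n. c *\<^sub>R u n) (\<lambda>n. c *\<^sub>R v n)"
    by (simp add: inj_equiv_def inj_Cauchy_scaleR inj_norm_scaleR flip: scaleR_diff_right)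
qed

definition uminus_inj_tensor :: "('a, 'b) inj_tensor \<Rightarrow> ('a, 'b) inj_tensor" where
  "- z = (- 1) *\<^sub>R (z :: ('a, 'b) inj_tensor)"

definition minus_inj_tensor ::
    "('a, 'b) inj_tensor \<Rightarrow> ('a, 'b) inj_tensor \<Rightarrow> ('a, 'b) inj_tensor" where
  "w - z = w + - (z :: ('a, 'b) inj_tensor)"

lift_definition norm_inj_tensor :: "('a, 'b) inj_tensor \<Rightarrow> real"
  is "\<lambda>u. lim (\<lambda>n. inj_norm (u n))"
proof -
  fix u v :: "nat \<Rightarrow> ('a, 'b) alg_tensor"
  assume *: "inj_equiv u v"
  then have u: "(\<lambda>n. inj_norm (u n)) \<longlonglongrightarrow> lim (\<lambda>n. inj_norm (u n))"
    and v: "(\<lambda>n. inj_norm (v n)) \<longlonglongrightarrow> lim (\<lambda>n. inj_norm (v n))"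
    and uv: "(\<lambda>n. inj_norm (u n - v n)) \<longlonglongrightarrow> 0"
    by (auto simp: inj_equiv_def intro: inj_Cauchy_norm_tendsto)
  have "(\<lambda>n. inj_norm (u n) - inj_norm (v n)) \<longlonglongrightarrow> 0"
    by (rule Lim_null_comparison[OF _ uv]) (simp add: abs_inj_norm_diff)
  with tendsto_diff[OF u v] show "lim (\<lambda>n. inj_norm (u n)) = lim (\<lambda>n. inj_norm (v n))"
    using LIMSEQ_unique by fastforce
qed

definition sgn_inj_tensor :: "('a, 'b) inj_tensor \<Rightarrow> ('a, 'b) inj_tensor" where
  "sgn z = inverse (norm z) *\<^sub>R (z :: ('a, 'b) inj_tensor)"

definition dist_inj_tensor :: "('a, 'b) inj_tensor \<Rightarrow> ('a, 'b) inj_tensor \<Rightarrow> real" where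
  "dist w z = norm (w - z :: ('a, 'b) inj_tensor)"

definition uniformity_inj_tensor :: "(('a, 'b) inj_tensor \<times> ('a, 'b) inj_tensor) filter" where
  "uniformity_inj_tensor = (INF e\<in>{0<..}. principal {(w, z). dist w z < (e :: real)})"

definition open_inj_tensor :: "('a, 'b) inj_tensor set \<Rightarrow> bool" where
  "open_inj_tensor U \<longleftrightarrow>
     (\<forall>w\<in>U. eventually (\<lambda>(w', z). w' = w \<longrightarrow> z \<in> U) uniformity)"

instance
proof
  fix a b c :: "('a, 'b) inj_tensor" and r s :: real and U :: "('a, 'b) inj_tensor set"
  show "a + b + c = a + (b + c)"
    by transfer (auto simp: inj_equiv_def inj_Cauchy_add add.assoc)
  show "a + b = b + a"
    by transfer (auto simp: inj_equiv_def inj_Cauchy_add add.commute)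
  show "0 + a = a"
    by transfer (auto simp: inj_equiv_def)
  show "- a + a = 0" unfolding uminus_inj_tensor_def
    by transfer (auto simp: inj_equiv_def inj_Cauchy_const)
  show "a - b = a + - b" by (simp add: minus_inj_tensor_def)
  show "r *\<^sub>R (a + b) = r *\<^sub>R a + r *\<^sub>R b"
    by transfer (auto simp: inj_equiv_def inj_Cauchy_add inj_Cauchy_scaleR scaleR_add_right)
  show "(r + s) *\<^sub>R a = r *\<^sub>R a + s *\<^sub>R a"
    by transfer (auto simp: inj_equiv_refl_iff inj_Cauchy_add inj_Cauchy_scaleR scaleR_add_left)
  show "r *\<^sub>R s *\<^sub>R a = (r * s) *\<^sub>R a"
    by transfer (auto simp: inj_equiv_def inj_Cauchy_scaleR)
  show "1 *\<^sub>R a = a"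
    by transfer (auto simp: inj_equiv_def)
  show "sgn a = inverse (norm a) *\<^sub>R a" by (simp add: sgn_inj_tensor_def)
  show "dist a b = norm (a - b)" by (simp add: dist_inj_tensor_def)
  show "(uniformity :: (('a, 'b) inj_tensor \<times> ('a, 'b) inj_tensor) filter) =
      (INF e\<in>{0<..}. principal {(w, z). dist w z < e})"
    by (rule uniformity_inj_tensor_def)
  show "open U = (\<forall>w\<in>U. eventually (\<lambda>(w', z). w' = w \<longrightarrow> z \<in> U) uniformity)"
    by (rule open_inj_tensor_def)
  show "norm a = 0 \<longleftrightarrow> a = 0"
  proof transfer
    fix u :: "nat \<Rightarrow> ('a, 'b) alg_tensor"
    assume "inj_equiv u u"
    then have u: "inj_Cauchy u" by (simp add: inj_equiv_refl_iff)
    show "lim (\<lambda>n. inj_norm (u n)) = 0 \<longleftrightarrow> inj_equiv u (\<lambda>_. 0)"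
      using inj_Cauchy_norm_tendsto[OF u] u
      by (auto simp: inj_equiv_def inj_Cauchy_const dest: limI)
  qed
  show "norm (a + b) \<le> norm a + norm b"
  proof transfer
    fix u v :: "nat \<Rightarrow> ('a, 'b) alg_tensor"
    assume "inj_equiv u u" "inj_equiv v v"
    then have u: "inj_Cauchy u" and v: "inj_Cauchy v" by (simp_all add: inj_equiv_refl_iff)
    show "lim (\<lambda>n. inj_norm (u n + v n)) \<le> lim (\<lambda>n. inj_norm (u n)) + lim (\<lambda>n. inj_norm (v n))"
      by (rule tendsto_le[OF _ tendsto_add[OF inj_Cauchy_norm_tendsto[OF u]
              inj_Cauchy_norm_tendsto[OF v]] inj_Cauchy_norm_tendsto[OF inj_Cauchy_add[OF u v]]])
        (auto simp: inj_norm_triangle)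
  qed
  show "norm (r *\<^sub>R a) = \<bar>r\<bar> * norm a"
  proof transfer
    fix r :: real and u :: "nat \<Rightarrow> ('a, 'b) alg_tensor"
    assume "inj_equiv u u"
    then have u: "inj_Cauchy u" by (simp add: inj_equiv_refl_iff)
    show "lim (\<lambda>n. inj_norm (r *\<^sub>R u n)) = \<bar>r\<bar> * lim (\<lambda>n. inj_norm (u n))"
      using tendsto_mult[OF tendsto_const inj_Cauchy_norm_tendsto[OF u]]
      by (intro limI) (simp add: inj_norm_scaleR)
  qed
qed

end

definition inj_embed ::
    "('a::real_normed_vector, 'b::real_normed_vector) alg_tensor \<Rightarrow> ('a, 'b) inj_tensor" where
  "inj_embed t = abs_inj_tensor (\<lambda>_. t)"

lemma norm_inj_embed: "norm (inj_embed t) = inj_norm t"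
  by (simp add: inj_embed_def norm_inj_tensor.abs_eq inj_equiv_refl_iff inj_Cauchy_const)

lemma linear_inj_embed: "linear inj_embed"
  by (rule linearI) (simp_all add: inj_embed_def plus_inj_tensor.abs_eq
      scaleR_inj_tensor.abs_eq inj_equiv_refl_iff inj_Cauchy_const)

lemma inj_embed_tendsto:
  assumes u: "inj_Cauchy u"
  shows "(\<lambda>n. inj_embed (u n)) \<longlonglongrightarrow> abs_inj_tensor u"
proof (rule metric_LIMSEQ_I)
  fix e :: real assume "0 < e"
  then have "0 < e / 2" by simp
  with u obtain N where N: "\<And>m n. m \<ge> N \<Longrightarrow> n \<ge> N \<Longrightarrow> inj_norm (u m - u n) < e / 2"
    unfolding inj_Cauchy_def by blast
  have "dist (inj_embed (u n)) (abs_inj_tensor u) < e" if n: "n \<ge> N" for n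
  proof -
    let ?w = "\<lambda>m. u n + (- 1) *\<^sub>R u m"
    have w: "inj_Cauchy ?w"
      by (intro inj_Cauchy_add inj_Cauchy_const inj_Cauchy_scaleR u)
    have eq: "inj_embed (u n) - abs_inj_tensor u = abs_inj_tensor ?w"
      unfolding minus_inj_tensor_def uminus_inj_tensor_def inj_embed_def
      by (simp only: scaleR_inj_tensor.abs_eq plus_inj_tensor.abs_eq inj_equiv_refl_iff
          inj_Cauchy_const u inj_Cauchy_scaleR[OF u])
    have "lim (\<lambda>m. inj_norm (?w m)) \<le> e / 2"
    proof (rule LIMSEQ_le_const2[OF inj_Cauchy_norm_tendsto[OF w]])
      show "\<exists>M. \<forall>m\<ge>M. inj_norm (?w m) \<le> e / 2"
        using N[OF n] by (auto intro!: exI[of _ N] less_imp_le)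
    qed
    then have "norm (abs_inj_tensor ?w) \<le> e / 2"
      using w by (simp add: norm_inj_tensor.abs_eq inj_equiv_refl_iff)
    with \<open>0 < e\<close> show ?thesis by (simp add: dist_norm eq)
  qed
  then show "\<exists>N. \<forall>n\<ge>N. dist (inj_embed (u n)) (abs_inj_tensor u) < e" by blast
qed

lemma abs_inj_tensor_cases:
  obtains u where "inj_Cauchy u" "z = abs_inj_tensor u"
  using that[of "rep_inj_tensor z"] Quotient_inj_tensor
  by (metis Quotient_abs_rep Quotient_rep_reflp inj_equiv_refl_iff)

lemma closure_range_inj_embed: "closure (range inj_embed) = UNIV"
proof -
  have "z \<in> closure (range inj_embed)" for z :: "('a, 'b) inj_tensor"
  proof (rule abs_inj_tensor_cases[of z])
    fix u assume "inj_Cauchy u" "z = abs_inj_tensor u"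
    with inj_embed_tendsto[of u] show ?thesis
      unfolding closure_sequential by (auto intro!: exI[of _ "\<lambda>n. inj_embed (u n)"])
  qed
  then show ?thesis by auto
qed

instance inj_tensor :: (real_normed_vector, real_normed_vector) banach
proof
  fix X :: "nat \<Rightarrow> ('a, 'b) inj_tensor"
  assume X: "Cauchy X"
  have "\<exists>t. dist (inj_embed t) (X n) < inverse (real (Suc n))" for n
  proof -
    have "X n \<in> closure (range inj_embed)" by (simp add: closure_range_inj_embed)
    then have "\<exists>y\<in>range inj_embed. dist y (X n) < inverse (real (Suc n))"
      unfolding closure_approachable by simp
    then show ?thesis by auto
  qed
  then obtain t where t: "\<And>n. dist (inj_embed (t n)) (X n) < inverse (real (Suc n))"
    by metis
  have lim0: "(\<lambda>n. dist (inj_embed (t n)) (X n)) \<longlonglongrightarrow> 0"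
    by (rule tendsto_sandwich[OF _ _ tendsto_const LIMSEQ_inverse_real_of_nat])
      (auto intro!: always_eventually less_imp_le[OF t] simp del: of_nat_Suc)
  have diff0: "(\<lambda>n. inj_embed (t n) - X n) \<longlonglongrightarrow> 0"
    using lim0 by (simp add: dist_norm tendsto_norm_zero_iff)
  have "Cauchy (\<lambda>n. inj_embed (t n))"
  proof (rule metric_CauchyI)
    fix e :: real assume "0 < e"
    then have e: "0 < e / 3" by simp
    from metric_CauchyD[OF X e] obtain M
      where M: "\<And>m n. m \<ge> M \<Longrightarrow> n \<ge> M \<Longrightarrow> dist (X m) (X n) < e / 3" by blast
    from metric_LIMSEQ_D[OF lim0 e] obtain N
      where N: "\<And>n. n \<ge> N \<Longrightarrow> dist (inj_embed (t n)) (X n) < e / 3" by auto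
    have "dist (inj_embed (t m)) (inj_embed (t n)) < e" if "m \<ge> max M N" "n \<ge> max M N" for m n
    proof -
      have "dist (X m) (X n) < e / 3" using M that by simp
      moreover have "dist (inj_embed (t m)) (X m) < e / 3" "dist (inj_embed (t n)) (X n) < e / 3"
        using N that by simp_all
      ultimately show ?thesis
        using dist_triangle[of "inj_embed (t m)" "inj_embed (t n)" "X m"]
          dist_triangle[of "X m" "inj_embed (t n)" "X n"]
        by (simp add: dist_commute)
    qed
    then show "\<exists>M. \<forall>m\<ge>M. \<forall>n\<ge>M. dist (inj_embed (t m)) (inj_embed (t n)) < e" by blast
  qed
  then have "inj_Cauchy t"
    unfolding inj_Cauchy_def Cauchy_iff
    by (simp add: norm_inj_embed flip: linear_diff[OF linear_inj_embed])
  then have "(\<lambda>n. inj_embed (t n)) \<longlonglongrightarrow> abs_inj_tensor t" by (rule inj_embed_tendsto)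
  from tendsto_diff[OF this diff0] have "X \<longlonglongrightarrow> abs_inj_tensor t" by simp
  then show "convergent X" by (rule convergentI)
qed


section \<open>Weak-star slices of dual balls\<close>

text \<open>The dual of \<open>'a\<close> is \<open>'a \<Rightarrow>\<^sub>L real\<close> with the operator norm.\<close>

definition w_star_slice :: "'a::real_normed_vector \<Rightarrow> real \<Rightarrow> ('a \<Rightarrow>\<^sub>L real) set" where
  "w_star_slice z \<alpha> = {f \<in> cball 0 1. blinfun_apply f z > 1 - \<alpha>}"

definition is_w_star_slice :: "('a::real_normed_vector \<Rightarrow>\<^sub>L real) set \<Rightarrow> bool" where
  "is_w_star_slice S \<longleftrightarrow> (\<exists>z \<alpha>. z \<in> sphere 0 1 \<and> 0 < \<alpha> \<and> \<alpha> < 1 \<and> S = w_star_slice z \<alpha>)"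

text \<open>Both properties concern the dual of \<open>'a\<close> but depend on the predual, so they are
  predicates on the predual type.\<close>

definition dual_w_star_BDP :: "'a::real_normed_vector itself \<Rightarrow> bool" where
  "dual_w_star_BDP _ \<longleftrightarrow>
     (\<forall>\<epsilon>>0. \<exists>S :: ('a \<Rightarrow>\<^sub>L real) set. is_w_star_slice S \<and> diameter S < \<epsilon>)"

definition dual_w_star_BSCSP :: "'a::real_normed_vector itself \<Rightarrow> bool" where
  "dual_w_star_BSCSP _ \<longleftrightarrow>
     (\<forall>\<epsilon>>0. \<exists>(n::nat) (S :: nat \<Rightarrow> ('a \<Rightarrow>\<^sub>L real) set) (l :: nat \<Rightarrow> real).
        (\<forall>i\<in>{1..n}. is_w_star_slice (S i)) \<and>
        (\<forall>i\<in>{1..n}. 0 \<le> l i) \<and> (\<Sum>i=1..n. l i) = 1 \<and>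
        diameter {\<Sum>i=1..n. l i *\<^sub>R f i | f. \<forall>i\<in>{1..n}. f i \<in> S i} < \<epsilon>)"

end

theory Submission
  imports Defs
begin

text \<open>
  The idea is that a functional \<open>F\<close> which nearly attains its norm at an elementary tensor
  \<open>x\<^sub>0 \<otimes> y\<^sub>i\<close>, where \<open>x\<^sub>0\<close> determines a \<open>w*\<close>-slice of \<open>B\<^bsub>X*\<^esub>\<close> of small diameter, is close in norm to
  a product \<open>f\<^sub>0 \<otimes> g\<close>: here \<open>f\<^sub>0\<close> is any fixed member of that slice, and \<open>g = F(x\<^sub>0 \<otimes> \<sqdot>)\<close> lies in the
  \<open>w*\<close>-slice of \<open>B\<^bsub>Y*\<^esub>\<close> given by \<open>y\<^sub>i\<close>.  If slices \<open>T\<^sub>i\<close> of \<open>B\<^bsub>Y*\<^esub>\<close>, given by \<open>y\<^sub>i\<close>, have a small convex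
  combination with weights \<open>\<lambda>\<^sub>i\<close>, then so have the slices of the dual ball of the injective tensor
  product given by \<open>x\<^sub>0 \<otimes> y\<^sub>i\<close>, because \<open>\<Sum> \<lambda>\<^sub>i F\<^sub>i\<close> is close to \<open>f\<^sub>0 \<otimes> \<Sum> \<lambda>\<^sub>i g\<^sub>i\<close> and \<open>\<Sum> \<lambda>\<^sub>i g\<^sub>i\<close> varies only
  within the small set \<open>\<Sum> \<lambda>\<^sub>i T\<^sub>i\<close>.

  Closeness to a product (\<open>slice_functional_near_product\<close>) comes from testing \<open>F\<close> on a suitable
  tensor.  For a tensor \<open>t\<close> put \<open>r = t - x\<^sub>0 \<otimes> (f\<^sub>0 \<otimes> id)(t)\<close>; the aim is to bound
  \<open>F(r)\<close>, which is the difference of \<open>F\<close> and \<open>f\<^sub>0 \<otimes> g\<close> at \<open>t\<close>.  At a pair \<open>(f, g)\<close> of unit functionals,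
  \<open>r\<close> is small when \<open>\<plusminus>f\<close> is in the slice of \<open>x\<^sub>0\<close>, and in the opposite case \<open>|f(x\<^sub>0)|\<close> stays away from
  \<open>1\<close>.  Hence for a suitable constant \<open>c\<close> the norm of \<open>c x\<^sub>0 \<otimes> y\<^sub>i + r\<close> hardly exceeds \<open>c\<close>.  Since
  \<open>F(c x\<^sub>0 \<otimes> y\<^sub>i)\<close> is already almost \<open>c\<close>, little is left for \<open>F(r)\<close>.

  Norming functionals are used to see that \<open>x\<^sub>0 \<otimes> y\<^sub>i\<close> has norm one, that the slice of \<open>x\<^sub>0\<close>
  contains some \<open>f\<^sub>0\<close>, and that \<open>(f\<^sub>0 \<otimes> id)(t)\<close> is bounded by the injective norm of \<open>t\<close>.
\<close>

section \<open>Norming functionals\<close>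

text \<open>Homogeneity is stated as an inequality, which is what an argument with infima yields at once;
  equality follows by scaling back (\<open>sublinear_scaleR\<close>).\<close>

definition sublinear :: "('a::real_vector \<Rightarrow> real) \<Rightarrow> bool" where
  "sublinear q \<longleftrightarrow> (\<forall>x y. q (x + y) \<le> q x + q y) \<and> (\<forall>c x. 0 \<le> c \<longrightarrow> q (c *\<^sub>R x) \<le> c * q x)"

lemma sublinear_add: "sublinear q \<Longrightarrow> q (x + y) \<le> q x + q y"
  and sublinear_scaleR_le: "sublinear q \<Longrightarrow> 0 \<le> c \<Longrightarrow> q (c *\<^sub>R x) \<le> c * q x"
  by (simp_all add: sublinear_def)

lemma sublinear_0:
  assumes "sublinear q"
  shows "q 0 = 0"
  using sublinear_add[OF assms, of 0 0] sublinear_scaleR_le[OF assms, of 0 0] by simp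

lemma sublinear_minus: "sublinear q \<Longrightarrow> - q (- x) \<le> q x"
  using sublinear_add[of q x "- x"] sublinear_0[of q] by simp

lemma sublinear_scaleR:
  assumes q: "sublinear q" and c: "0 \<le> c"
  shows "q (c *\<^sub>R x) = c * q x"
proof (cases "c = 0")
  case True
  then show ?thesis by (simp add: sublinear_0[OF q])
next
  case False
  have "q (inverse c *\<^sub>R (c *\<^sub>R x)) \<le> inverse c * q (c *\<^sub>R x)"
    using c by (intro sublinear_scaleR_le[OF q]) simp
  then have "c * q x \<le> q (c *\<^sub>R x)"
    using False c by (simp add: field_simps)
  with sublinear_scaleR_le[OF q c, of x] show ?thesis by simp
qed

text \<open>The largest sublinear functional below \<open>q\<close> that agrees with \<open>q\<close> at \<open>y\<close> and is linear on the
  line through \<open>y\<close>.  It serves twice: a functional that it lowers for no \<open>y\<close> is additive, and a linear functional below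
  \<open>straighten norm x\<close> attains the norm at \<open>x\<close>.\<close>

definition straighten :: "('a::real_vector \<Rightarrow> real) \<Rightarrow> 'a \<Rightarrow> 'a \<Rightarrow> real" where
  "straighten q y x = (INF t\<in>{0..}. q (x + t *\<^sub>R y) - t * q y)"

lemma straighten_le:
  assumes q: "sublinear q" and t: "0 \<le> t"
  shows "straighten q y x \<le> q (x + t *\<^sub>R y) - t * q y"
  unfolding straighten_def
proof (rule cINF_lower)
  show "bdd_below ((\<lambda>t. q (x + t *\<^sub>R y) - t * q y) ` {0..})"
  proof (rule bdd_belowI2)
    fix t :: real assume "t \<in> {0..}"
    then have "t * q y = q (- x + (x + t *\<^sub>R y))" by (simp add: sublinear_scaleR[OF q])
    also have "\<dots> \<le> q (- x) + q (x + t *\<^sub>R y)" by (rule sublinear_add[OF q])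
    finally show "- q (- x) \<le> q (x + t *\<^sub>R y) - t * q y" by simp
  qed
qed (use t in simp)

lemma straighten_greatest:
  assumes "\<And>t. 0 \<le> t \<Longrightarrow> d \<le> q (x + t *\<^sub>R y) - t * q y"
  shows "d \<le> straighten q y x"
  unfolding straighten_def by (rule cINF_greatest) (use assms in auto)

lemma sublinear_straighten:
  assumes q: "sublinear q"
  shows "sublinear (straighten q y)"
  unfolding sublinear_def
proof (intro conjI allI impI)
  fix x x'
  have "straighten q y (x + x') - (q (x' + s *\<^sub>R y) - s * q y) \<le> q (x + t *\<^sub>R y) - t * q y"
    if s: "0 \<le> s" and t: "0 \<le> t" for s t
  proof -
    have "straighten q y (x + x') \<le> q (x + x' + (s + t) *\<^sub>R y) - (s + t) * q y"
      by (rule straighten_le[OF q]) (use s t in simp)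
    also have "x + x' + (s + t) *\<^sub>R y = (x + t *\<^sub>R y) + (x' + s *\<^sub>R y)"
      by (simp add: algebra_simps)
    finally show ?thesis
      using sublinear_add[OF q, of "x + t *\<^sub>R y" "x' + s *\<^sub>R y"] by (simp add: algebra_simps)
  qed
  then have "straighten q y (x + x') - (q (x' + s *\<^sub>R y) - s * q y) \<le> straighten q y x"
    if "0 \<le> s" for s
    using that by (intro straighten_greatest)
  then have "straighten q y (x + x') - straighten q y x \<le> straighten q y x'"
    by (intro straighten_greatest) (simp add: algebra_simps)
  then show "straighten q y (x + x') \<le> straighten q y x + straighten q y x'" by simp
next
  fix c :: real and x assume c: "0 \<le> c"
  have *: "straighten q y (c *\<^sub>R x) \<le> c * (q (x + t *\<^sub>R y) - t * q y)" if t: "0 \<le> t" for t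
  proof -
    have "straighten q y (c *\<^sub>R x) \<le> q (c *\<^sub>R x + (c * t) *\<^sub>R y) - (c * t) * q y"
      by (rule straighten_le[OF q]) (use c t in simp)
    also have "c *\<^sub>R x + (c * t) *\<^sub>R y = c *\<^sub>R (x + t *\<^sub>R y)" by (simp add: algebra_simps)
    also have "q (c *\<^sub>R (x + t *\<^sub>R y)) = c * q (x + t *\<^sub>R y)" by (rule sublinear_scaleR[OF q c])
    finally show ?thesis by (simp add: algebra_simps)
  qed
  show "straighten q y (c *\<^sub>R x) \<le> c * straighten q y x"
  proof (cases "c = 0")
    case True
    with *[of 0] show ?thesis by simp
  next
    case False
    with c have c: "0 < c" by simp
    have "straighten q y (c *\<^sub>R x) / c \<le> straighten q y x"
      by (rule straighten_greatest) (use * c in \<open>simp add: field_simps\<close>)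
    with c show ?thesis by (simp add: field_simps)
  qed
qed

text \<open>The common upper bound \<open>p\<close> keeps the infimum finite, as \<open>q x \<ge> - q (- x) \<ge> - p (- x)\<close>.  The chain
  condition gives subadditivity: two members of the chain are both bounded below by the smaller
  of them.\<close>

lemma sublinear_INF_chain:
  assumes "Q \<noteq> {}" and sub: "\<And>q. q \<in> Q \<Longrightarrow> sublinear q" and le: "\<And>q. q \<in> Q \<Longrightarrow> q \<le> p"
    and chain: "\<And>q r. q \<in> Q \<Longrightarrow> r \<in> Q \<Longrightarrow> q \<le> r \<or> r \<le> q"
  shows "sublinear (\<lambda>x. INF q\<in>Q. q x)" and "q \<in> Q \<Longrightarrow> (INF q\<in>Q. q x) \<le> q x"
proof -
  have lower: "(INF q\<in>Q. q x) \<le> q x" if "q \<in> Q" for q x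
  proof (rule cINF_lower[OF _ that])
    have "- p (- x) \<le> q x" if "q \<in> Q" for q
      using le_funD[OF le[OF that], of "- x"] sublinear_minus[OF sub[OF that], of x] by simp
    then show "bdd_below ((\<lambda>q. q x) ` Q)" by (rule bdd_belowI2)
  qed
  then show "q \<in> Q \<Longrightarrow> (INF q\<in>Q. q x) \<le> q x" .
  show "sublinear (\<lambda>x. INF q\<in>Q. q x)"
    unfolding sublinear_def
  proof (intro conjI allI impI)
    fix x y
    have pair: "(INF q\<in>Q. q (x + y)) \<le> q x + r y" if q: "q \<in> Q" and r: "r \<in> Q" for q r
    proof -
      obtain s where s: "s \<in> Q" "s x \<le> q x" "s y \<le> r y"
        using chain[OF q r] q r by (auto simp: le_fun_def)
      then show ?thesis
        using lower[OF s(1), of "x + y"] sublinear_add[OF sub[OF s(1)], of x y] by simp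
    qed
    have "(INF q\<in>Q. q (x + y)) - (INF q\<in>Q. q x) \<le> r y" if r: "r \<in> Q" for r
    proof -
      have "(INF q\<in>Q. q (x + y)) - r y \<le> (INF q\<in>Q. q x)"
        by (rule cINF_greatest[OF \<open>Q \<noteq> {}\<close>]) (use pair[OF _ r] in \<open>simp add: algebra_simps\<close>)
      then show ?thesis by simp
    qed
    then have "(INF q\<in>Q. q (x + y)) - (INF q\<in>Q. q x) \<le> (INF q\<in>Q. q y)"
      by (rule cINF_greatest[OF \<open>Q \<noteq> {}\<close>])
    then show "(INF q\<in>Q. q (x + y)) \<le> (INF q\<in>Q. q x) + (INF q\<in>Q. q y)" by simp
  next
    fix c :: real and x assume c: "0 \<le> c"
    have *: "(INF q\<in>Q. q (c *\<^sub>R x)) \<le> c * q x" if "q \<in> Q" for q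
      using lower[OF that, of "c *\<^sub>R x"] sublinear_scaleR_le[OF sub[OF that] c, of x] by simp
    show "(INF q\<in>Q. q (c *\<^sub>R x)) \<le> c * (INF q\<in>Q. q x)"
    proof (cases "c = 0")
      case True
      with * \<open>Q \<noteq> {}\<close> show ?thesis by fastforce
    next
      case False
      with c have c: "0 < c" by simp
      have "(INF q\<in>Q. q (c *\<^sub>R x)) / c \<le> (INF q\<in>Q. q x)"
        by (rule cINF_greatest[OF \<open>Q \<noteq> {}\<close>]) (use * c in \<open>simp add: field_simps\<close>)
      with c show ?thesis by (simp add: field_simps)
    qed
  qed
qed

lemma linear_if_minimal_sublinear:
  assumes m: "sublinear m" and min: "\<And>q. sublinear q \<Longrightarrow> q \<le> m \<Longrightarrow> q = m"
  shows "linear m"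
proof -
  have add: "m (x + y) = m x + m y" for x y
  proof -
    have "straighten m y x \<le> m x" for x
      using straighten_le[OF m, of 0 y x] by simp
    then have "straighten m y = m"
      by (intro min sublinear_straighten[OF m]) (simp add: le_fun_def)
    then have "m x \<le> m (x + y) - m y"
      using straighten_le[OF m, of 1 y x] by simp
    with sublinear_add[OF m, of x y] show ?thesis by simp
  qed
  have neg: "m (- x) = - m x" for x
    using add[of x "- x"] sublinear_0[OF m] by simp
  have "m (c *\<^sub>R x) = c * m x" for c x
  proof (cases "0 \<le> c")
    case False
    then have "m ((- c) *\<^sub>R (- x)) = (- c) * m (- x)"
      by (intro sublinear_scaleR[OF m]) simp
    then show ?thesis by (simp add: neg)
  qed (rule sublinear_scaleR[OF m])
  with add show ?thesis by (intro linearI) auto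
qed

text \<open>A form of the Hahn-Banach theorem.  Applying Zorn's lemma to sublinear functionals on the whole
  space, ordered downwards, avoids partially defined linear functionals.\<close>

lemma linear_below_sublinear:
  assumes p: "sublinear p"
  obtains f where "linear f" and "f \<le> p"
proof -
  define A where "A = {q. sublinear q \<and> q \<le> p}"
  have "\<exists>m\<in>A. \<forall>q\<in>A. q \<le> m \<longrightarrow> q = m"
  proof (rule predicate_Zorn)
    show "partial_order_on A (relation_of (\<lambda>q r. r \<le> q) A)"
      by (rule partial_order_on_relation_ofI) auto
    fix Q assume Q: "Q \<in> Chains (relation_of (\<lambda>q r. r \<le> q) A)"
    then have QA: "Q \<subseteq> A" by (rule Chains_relation_of)
    show "\<exists>u\<in>A. \<forall>q\<in>Q. u \<le> q"
    proof (cases "Q = {}")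
      case True
      with p show ?thesis by (auto simp: A_def)
    next
      case False
      have sub: "\<And>q. q \<in> Q \<Longrightarrow> sublinear q" and le: "\<And>q. q \<in> Q \<Longrightarrow> q \<le> p"
        using QA by (auto simp: A_def)
      have chain: "q \<le> r \<or> r \<le> q" if "q \<in> Q" "r \<in> Q" for q r
        using Q that by (auto simp: Chains_def relation_of_def)
      let ?u = "\<lambda>x. INF q\<in>Q. q x"
      have u: "?u \<le> q" if "q \<in> Q" for q
        using sublinear_INF_chain(2)[OF False sub le chain that] by (simp add: le_fun_def)
      have "sublinear ?u"
        by (rule sublinear_INF_chain(1)[OF False sub le chain])
      moreover have "?u \<le> p"
        using False u le order_trans by blast
      ultimately show ?thesis using u by (auto simp: A_def)
    qed
  qed
  then obtain m where m: "m \<in> A" and min: "\<And>q. q \<in> A \<Longrightarrow> q \<le> m \<Longrightarrow> q = m" by blast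
  have "linear m"
  proof (rule linear_if_minimal_sublinear)
    show "sublinear m" using m by (simp add: A_def)
    fix q assume "sublinear q" "q \<le> m"
    with m show "q = m" by (intro min) (auto simp: A_def)
  qed
  with m show thesis by (intro that) (auto simp: A_def)
qed

lemma norming_functional:
  fixes x :: "'a::real_normed_vector"
  assumes "x \<noteq> 0"
  obtains f :: "'a \<Rightarrow>\<^sub>L real" where "norm f = 1" and "blinfun_apply f x = norm x"
proof -
  have N: "sublinear (norm :: 'a \<Rightarrow> real)"
    by (simp add: sublinear_def norm_triangle_ineq)
  obtain h where h: "linear h" and le: "h \<le> straighten norm x"
    using linear_below_sublinear[OF sublinear_straighten[OF N]] by blast
  have h_le: "h y \<le> norm y" for y
    using le_funD[OF le, of y] straighten_le[OF N, of 0 x y] by simp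
  have abs_h: "\<bar>h y\<bar> \<le> norm y" for y
    using h_le[of y] h_le[of "- y"] by (simp add: linear_neg[OF h] abs_le_iff)
  have "h (- x) \<le> - norm x"
    using le_funD[OF le, of "- x"] straighten_le[OF N, of 1 x "- x"] by simp
  with h_le[of x] have hx: "h x = norm x" by (simp add: linear_neg[OF h])
  have bl: "bounded_linear h"
    using h abs_h by (auto intro!: bounded_linear_intro[where K = 1] simp: linear_add linear_scale)
  define f where "f = Blinfun h"
  have f: "blinfun_apply f = h" unfolding f_def by (rule bounded_linear_Blinfun_apply[OF bl])
  have "norm f = 1"
    by (rule norm_blinfun_eqI[where x = x]) (use assms hx abs_h in \<open>auto simp: f\<close>)
  then show thesis using hx by (intro that[of f]) (auto simp: f)
qed


section \<open>Functionals on the injective tensor product\<close>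

lemma eval_tensor_diff_left: "eval_tensor (f - f') g t = eval_tensor f g t - eval_tensor f' g t"
proof -
  obtain ps where t: "t = (\<Sum>(x, y)\<leftarrow>ps. tensor x y)" using alg_tensor_eq_sum by blast
  show ?thesis unfolding t eval_tensor_sum_list
    by (induction ps) (auto simp: blinfun.diff_left algebra_simps)
qed

lemma eval_tensor_scaleR_left: "eval_tensor (c *\<^sub>R f) g t = c * eval_tensor f g t"
proof -
  obtain ps where t: "t = (\<Sum>(x, y)\<leftarrow>ps. tensor x y)" using alg_tensor_eq_sum by blast
  show ?thesis unfolding t eval_tensor_sum_list
    by (induction ps) (auto simp: blinfun.scaleR_left algebra_simps)
qed

lemma abs_eval_tensor_le:
  assumes g: "norm g = 1"
  shows "\<bar>eval_tensor f g t\<bar> \<le> norm f * inj_norm t"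
proof (cases "f = 0")
  case True
  then show ?thesis using eval_tensor_scaleR_left[of 0 f g t] by simp
next
  case False
  have "\<bar>eval_tensor (norm f *\<^sub>R sgn f) g t\<bar> \<le> norm f * inj_norm t"
    unfolding eval_tensor_scaleR_left abs_mult
    by (simp, rule mult_left_mono[OF inj_norm_upper]) (use False g in \<open>simp_all add: norm_sgn\<close>)
  also have "norm f *\<^sub>R sgn f = f" using False by (simp add: sgn_div_norm)
  finally show ?thesis .
qed

lemma inj_norm_tensor_le: "inj_norm (tensor x y) \<le> norm x * norm y"
proof (rule inj_norm_least)
  fix f :: "'a \<Rightarrow>\<^sub>L real" and g :: "'b \<Rightarrow>\<^sub>L real"
  assume "norm f = 1" "norm g = 1"
  then have "\<bar>f x\<bar> \<le> norm x" "\<bar>g y\<bar> \<le> norm y"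
    using norm_blinfun[of f x] norm_blinfun[of g y] by simp_all
  then show "\<bar>eval_tensor f g (tensor x y)\<bar> \<le> norm x * norm y"
    by (simp add: abs_mult mult_mono)
qed simp

lemma inj_norm_tensor_unit:
  assumes x: "norm x = 1" and y: "norm y = 1"
  shows "inj_norm (tensor x y) = 1"
proof (rule antisym)
  show "inj_norm (tensor x y) \<le> 1" using inj_norm_tensor_le[of x y] x y by simp
  obtain f where f: "norm f = 1" "blinfun_apply f x = norm x"
    using norming_functional[of x] x by (metis norm_zero zero_neq_one)
  obtain g where g: "norm g = 1" "blinfun_apply g y = norm y"
    using norming_functional[of y] y by (metis norm_zero zero_neq_one)
  show "1 \<le> inj_norm (tensor x y)"
    using inj_norm_upper[OF f(1) g(1), of "tensor x y"] f(2) g(2) x y by simp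
qed

lemma norm_inj_functional_le:
  fixes F :: "('a::real_normed_vector, 'b::real_normed_vector) inj_tensor \<Rightarrow>\<^sub>L real"
  assumes "0 \<le> K" and bound: "\<And>t. \<bar>F (inj_embed t)\<bar> \<le> K * inj_norm t"
  shows "norm F \<le> K"
proof (rule norm_blinfun_bound[OF \<open>0 \<le> K\<close>])
  have "closed {z. \<bar>blinfun_apply F z\<bar> \<le> K * norm z}"
    by (intro closed_Collect_le continuous_intros)
  moreover have "range inj_embed \<subseteq> {z. \<bar>blinfun_apply F z\<bar> \<le> K * norm z}"
    using bound by (auto simp: norm_inj_embed)
  ultimately have "closure (range inj_embed) \<subseteq> {z. \<bar>blinfun_apply F z\<bar> \<le> K * norm z}"
    by (rule closure_minimal[rotated])
  then show "norm (blinfun_apply F z) \<le> K * norm z" for z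
    by (auto simp: closure_range_inj_embed)
qed

text \<open>The map \<open>f \<otimes> id\<close> from \<open>X \<otimes> Y\<close> to \<open>Y\<close>.\<close>

definition contract_left ::
    "('a::real_normed_vector \<Rightarrow>\<^sub>L real) \<Rightarrow> ('a, 'b::real_normed_vector) alg_tensor \<Rightarrow> 'b" where
  "contract_left f = (THE L. linear L \<and> (\<forall>x y. L (tensor x y) = blinfun_apply f x *\<^sub>R y))"

lemma contract_left:
  shows linear_contract_left: "linear (contract_left f)"
    and contract_left_tensor: "contract_left f (tensor x y) = blinfun_apply f x *\<^sub>R y"
proof -
  have "bilinear (\<lambda>x y. blinfun_apply f x *\<^sub>R y)"
    by (auto simp: bilinear_def blinfun.add_right blinfun.scaleR_right algebra_simps
        intro!: linearI)
  from theI'[OF alg_tensor_universal[OF this]]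
  show "linear (contract_left f)" "contract_left f (tensor x y) = blinfun_apply f x *\<^sub>R y"
    unfolding contract_left_def by blast+
qed

lemma apply_contract_left: "blinfun_apply g (contract_left f t) = eval_tensor f g t"
proof -
  obtain ps where t: "t = (\<Sum>(x, y)\<leftarrow>ps. tensor x y)" using alg_tensor_eq_sum by blast
  show ?thesis unfolding t eval_tensor_sum_list
    by (induction ps)
      (auto simp: linear_0[OF linear_contract_left] linear_add[OF linear_contract_left]
        contract_left_tensor blinfun.add_right blinfun.scaleR_right)
qed

lemma norm_contract_left_le:
  assumes f: "norm f \<le> 1"
  shows "norm (contract_left f t) \<le> inj_norm t"
proof (cases "contract_left f t = 0")
  case True
  then show ?thesis by (simp add: inj_norm_nonneg)
next
  case False
  then obtain g :: "'b \<Rightarrow>\<^sub>L real"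
    where g: "norm g = 1" "blinfun_apply g (contract_left f t) = norm (contract_left f t)"
    by (rule norming_functional)
  have "norm (contract_left f t) = eval_tensor f g t"
    by (simp add: apply_contract_left flip: g(2))
  also have "\<dots> \<le> norm f * inj_norm t"
    using abs_eval_tensor_le[OF g(1), of f t] by simp
  also have "\<dots> \<le> inj_norm t"
    using f by (simp add: inj_norm_nonneg mult_left_le_one_le)
  finally show ?thesis .
qed

lemma norm_functional_tensor_le:
  fixes F :: "('a::real_normed_vector, 'b::real_normed_vector) inj_tensor \<Rightarrow>\<^sub>L real"
  shows "norm (F (inj_embed (tensor x y))) \<le> norm F * norm x * norm y"
proof -
  have "norm (F (inj_embed (tensor x y))) \<le> norm F * inj_norm (tensor x y)"
    using norm_blinfun[of F "inj_embed (tensor x y)"] by (simp add: norm_inj_embed)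
  also have "\<dots> \<le> norm F * (norm x * norm y)"
    by (rule mult_left_mono[OF inj_norm_tensor_le]) simp
  finally show ?thesis by (simp add: mult.assoc)
qed

lemma bounded_linear_partial_functional:
  fixes F :: "('a::real_normed_vector, 'b::real_normed_vector) inj_tensor \<Rightarrow>\<^sub>L real"
  shows "bounded_linear (\<lambda>y. F (inj_embed (tensor x y)))"
proof (rule bounded_linear_intro)
  show "F (inj_embed (tensor x (y + y'))) = F (inj_embed (tensor x y)) + F (inj_embed (tensor x y'))"
    for y y'
    by (simp add: bilinear_radd[OF bilinear_tensor] linear_add[OF linear_inj_embed]
        blinfun.add_right)
  show "F (inj_embed (tensor x (c *\<^sub>R y))) = c *\<^sub>R F (inj_embed (tensor x y))" for c y
    by (simp add: bilinear_rmul[OF bilinear_tensor] linear_scale[OF linear_inj_embed]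
        blinfun.scaleR_right)
  show "norm (F (inj_embed (tensor x y))) \<le> norm y * (norm F * norm x)" for y
    using norm_functional_tensor_le[of F x y] by (simp add: mult_ac)
qed

definition partial_functional ::
    "(('a::real_normed_vector, 'b::real_normed_vector) inj_tensor \<Rightarrow>\<^sub>L real) \<Rightarrow> 'a \<Rightarrow>
     ('b \<Rightarrow>\<^sub>L real)" where
  "partial_functional F x = Blinfun (\<lambda>y. F (inj_embed (tensor x y)))"

lemma partial_functional_apply:
  "blinfun_apply (partial_functional F x) y = F (inj_embed (tensor x y))"
  by (simp add: partial_functional_def
      bounded_linear_Blinfun_apply[OF bounded_linear_partial_functional])

lemma norm_partial_functional_le: "norm (partial_functional F x) \<le> norm F * norm x"
  by (rule norm_blinfun_bound)
    (simp_all add: partial_functional_apply norm_functional_tensor_le[unfolded real_norm_def])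


section \<open>Functionals in a slice given by an elementary tensor\<close>

text \<open>The bound comes from evaluating \<open>F\<close> at \<open>c x\<^sub>0 \<otimes> y\<^sub>0 + r\<close>, where \<open>r\<close> is the difference of \<open>t\<close> and
  \<open>x\<^sub>0 \<otimes> (f\<^sub>0 \<otimes> id)(t)\<close>.  At unit functionals \<open>f\<close>, \<open>g\<close> the value of this tensor is
  \<open>c f(x\<^sub>0) g(y\<^sub>0) + t(f, g) - f(x\<^sub>0) t(f\<^sub>0, g)\<close>.
  If \<open>|f(x\<^sub>0)| \<le> 1 - \<alpha>\<close>, the first summand falls short of \<open>c\<close> by at least \<open>c \<alpha>\<close>, which
  compensates for the others.  Otherwise one of \<open>f\<close> and \<open>-f\<close> is within \<open>\<delta>\<close> of \<open>f\<^sub>0\<close>, and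
  the other summands nearly cancel.  The term \<open>2 \<eta> / \<alpha>\<close> is the price \<open>c \<eta>\<close> for \<open>F(x\<^sub>0 \<otimes> y\<^sub>0)\<close> being
  only \<open>1 - \<eta>\<close>.\<close>

lemma slice_functional_near_product:
  fixes F :: "('a::real_normed_vector, 'b::real_normed_vector) inj_tensor \<Rightarrow>\<^sub>L real"
  assumes x0: "norm x0 = 1" and y0: "norm y0 = 1" and f0: "norm f0 \<le> 1"
    and \<alpha>: "0 < \<alpha>"
    and near: "\<And>f. f \<in> w_star_slice x0 \<alpha> \<Longrightarrow> norm (f - f0) \<le> \<delta>"
    and F: "F \<in> w_star_slice (inj_embed (tensor x0 y0)) \<eta>"
  shows "\<bar>F (inj_embed t) - partial_functional F x0 (contract_left f0 t)\<bar>
      \<le> (\<delta> + \<alpha> + 2 * \<eta> / \<alpha>) * inj_norm t"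
proof -
  have F1: "norm F \<le> 1" and Fy: "1 - \<eta> < F (inj_embed (tensor x0 y0))"
    using F by (simp_all add: w_star_slice_def)
  define r where "r t = t - tensor x0 (contract_left f0 t)" for t :: "('a, 'b) alg_tensor"
  have eval_r: "eval_tensor f g (r t) = eval_tensor f g t - f x0 * eval_tensor f0 g t" for f g t
    using eval_tensor_add[of f g "r t" "tensor x0 (contract_left f0 t)"]
    by (simp add: r_def apply_contract_left)
  \<comment> \<open>The slice of \<open>x\<^sub>0\<close> is nonempty, so \<open>\<delta>\<close> bounds the norm of some vector.\<close>
  have \<delta>: "0 \<le> \<delta>"
  proof -
    obtain f where f: "norm f = 1" "blinfun_apply f x0 = norm x0"
      using norming_functional[of x0] x0 by (metis norm_zero zero_neq_one)
    with x0 \<alpha> have "f \<in> w_star_slice x0 \<alpha>" by (simp add: w_star_slice_def)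
    from near[OF this] show ?thesis using norm_ge_zero order_trans by blast
  qed
  have upper: "F (inj_embed (r t)) \<le> (\<delta> + \<alpha> + 2 * \<eta> / \<alpha>) * inj_norm t" for t
  proof -
    define N where "N = inj_norm t"
    have N: "0 \<le> N" by (simp add: N_def inj_norm_nonneg)
    \<comment> \<open>The least \<open>c\<close> for which the loss \<open>c \<alpha>\<close> makes up for the bound \<open>2 N\<close> on the value of \<open>r t\<close>.\<close>
    define c where "c = 2 * N / \<alpha>"
    have c: "0 \<le> c" using N \<alpha> by (simp add: c_def)
    have "inj_norm (c *\<^sub>R tensor x0 y0 + r t) \<le> c + (\<delta> + \<alpha>) * N"
    proof (rule inj_norm_least)
      show "0 \<le> c + (\<delta> + \<alpha>) * N" using c \<delta> \<alpha> N by simp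
      fix f :: "'a \<Rightarrow>\<^sub>L real" and g :: "'b \<Rightarrow>\<^sub>L real"
      assume f: "norm f = 1" and g: "norm g = 1"
      have fx: "\<bar>f x0\<bar> \<le> 1" and gy: "\<bar>g y0\<bar> \<le> 1"
        using norm_blinfun[of f x0] norm_blinfun[of g y0] f g x0 y0 by simp_all
      have tf: "\<bar>eval_tensor f g t\<bar> \<le> N"
        using abs_eval_tensor_le[OF g, of f t] f by (simp add: N_def)
      have "norm f0 * N \<le> N"
        using f0 N by (simp add: mult_left_le_one_le)
      then have tf0: "\<bar>eval_tensor f0 g t\<bar> \<le> N"
        using abs_eval_tensor_le[OF g, of f0 t] by (simp add: N_def)
      have "\<bar>c * (f x0 * g y0)\<bar> + \<bar>eval_tensor f g t - f x0 * eval_tensor f0 g t\<bar>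
          \<le> c + (\<delta> + \<alpha>) * N"
      proof (cases "1 - \<alpha> < \<bar>f x0\<bar>")
        case False
        have "\<bar>f x0 * g y0\<bar> \<le> (1 - \<alpha>) * 1"
          unfolding abs_mult using False gy by (intro mult_mono) auto
        then have "\<bar>c * (f x0 * g y0)\<bar> \<le> c * (1 - \<alpha>)"
          using c by (simp add: abs_mult mult_left_mono)
        also have "\<dots> = c - 2 * N" using \<alpha> by (simp add: c_def field_simps)
        finally have 1: "\<bar>c * (f x0 * g y0)\<bar> \<le> c - 2 * N" .
        have "\<bar>f x0 * eval_tensor f0 g t\<bar> \<le> 1 * N"
          unfolding abs_mult using fx tf0 by (intro mult_mono) auto
        with tf 1 have "\<bar>c * (f x0 * g y0)\<bar> + \<bar>eval_tensor f g t - f x0 * eval_tensor f0 g t\<bar> \<le> c"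
          by simp
        moreover have "0 \<le> (\<delta> + \<alpha>) * N" using \<delta> \<alpha> N by simp
        ultimately show ?thesis by simp
      next
        case True
        define s :: real where "s = (if f x0 < 0 then - 1 else 1)"
        have s: "\<bar>s\<bar> = 1" "s * f x0 = \<bar>f x0\<bar>" by (simp_all add: s_def)
        have "s *\<^sub>R f \<in> w_star_slice x0 \<alpha>"
          using True f s by (simp add: w_star_slice_def blinfun.scaleR_left)
        then have "norm (s *\<^sub>R f - f0) * N \<le> \<delta> * N"
          using near N by (intro mult_right_mono) auto
        then have 1: "\<bar>eval_tensor (s *\<^sub>R f - f0) g t\<bar> \<le> \<delta> * N"
          using abs_eval_tensor_le[OF g, of "s *\<^sub>R f - f0" t] by (simp add: N_def)
        have "\<bar>(1 - \<bar>f x0\<bar>) * eval_tensor f0 g t\<bar> \<le> \<alpha> * N"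
          unfolding abs_mult using True fx tf0 \<alpha> by (intro mult_mono) auto
        moreover have "s * (eval_tensor f g t - f x0 * eval_tensor f0 g t)
            = eval_tensor (s *\<^sub>R f - f0) g t + (1 - \<bar>f x0\<bar>) * eval_tensor f0 g t"
          by (simp add: eval_tensor_diff_left eval_tensor_scaleR_left algebra_simps flip: s(2))
        ultimately have "\<bar>s * (eval_tensor f g t - f x0 * eval_tensor f0 g t)\<bar> \<le> (\<delta> + \<alpha>) * N"
          using 1 by (simp add: distrib_right)
        then have 2: "\<bar>eval_tensor f g t - f x0 * eval_tensor f0 g t\<bar> \<le> (\<delta> + \<alpha>) * N"
          using s(1) by (simp add: abs_mult)
        have "\<bar>f x0 * g y0\<bar> \<le> 1 * 1"
          unfolding abs_mult using fx gy by (intro mult_mono) auto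
        then have "\<bar>c * (f x0 * g y0)\<bar> \<le> c"
          using c by (simp add: abs_mult mult_left_le)
        with 2 show ?thesis by simp
      qed
      then show "\<bar>eval_tensor f g (c *\<^sub>R tensor x0 y0 + r t)\<bar> \<le> c + (\<delta> + \<alpha>) * N"
        by (simp add: eval_tensor_add eval_tensor_scaleR eval_r)
    qed
    moreover have "c * F (inj_embed (tensor x0 y0)) + F (inj_embed (r t))
        \<le> inj_norm (c *\<^sub>R tensor x0 y0 + r t)"
    proof -
      have "norm F * inj_norm (c *\<^sub>R tensor x0 y0 + r t) \<le> inj_norm (c *\<^sub>R tensor x0 y0 + r t)"
        using F1 by (simp add: inj_norm_nonneg mult_left_le_one_le)
      with norm_blinfun[of F "inj_embed (c *\<^sub>R tensor x0 y0 + r t)"]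
      show ?thesis
        unfolding norm_inj_embed
        by (simp add: linear_add[OF linear_inj_embed]
            linear_scale[OF linear_inj_embed] blinfun.add_right blinfun.scaleR_right)
    qed
    moreover have "c * (1 - \<eta>) \<le> c * F (inj_embed (tensor x0 y0))"
      using c Fy by (intro mult_left_mono) auto
    ultimately have "F (inj_embed (r t)) \<le> (\<delta> + \<alpha>) * N + c * \<eta>"
      by (simp add: algebra_simps)
    then show ?thesis by (simp add: c_def N_def algebra_simps)
  qed
  have r_minus: "r (- t) = - r t"
    by (simp add: r_def linear_neg[OF linear_contract_left] bilinear_rneg[OF bilinear_tensor])
  have "\<bar>F (inj_embed (r t))\<bar> \<le> (\<delta> + \<alpha> + 2 * \<eta> / \<alpha>) * inj_norm t"
    using upper[of t] upper[of "- t"]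
    by (simp add: r_minus linear_neg[OF linear_inj_embed] blinfun.minus_right inj_norm_uminus
        abs_le_iff)
  then show ?thesis
    by (simp add: r_def partial_functional_apply linear_diff[OF linear_inj_embed]
        blinfun.diff_right)
qed


section \<open>Small combinations of slices\<close>

text \<open>Trades the diameter for a norm inequality.  The diameter bounds distances only in a bounded
  set, and a convex combination of slices is one because it lies in the unit ball.\<close>

lemma w_star_BSCSP_witness:
  assumes "dual_w_star_BSCSP TYPE('b::real_normed_vector)" and "0 < \<epsilon>"
  obtains n :: nat and y :: "nat \<Rightarrow> 'b::real_normed_vector" and \<beta> l :: "nat \<Rightarrow> real"
  where "\<And>i. i \<in> {1..n} \<Longrightarrow> norm (y i) = 1 \<and> 0 < \<beta> i"
    and "\<And>i. i \<in> {1..n} \<Longrightarrow> 0 \<le> l i" and "(\<Sum>i=1..n. l i) = 1"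
    and "\<And>g g'. \<lbrakk>\<And>i. i \<in> {1..n} \<Longrightarrow> g i \<in> w_star_slice (y i) (\<beta> i);
        \<And>i. i \<in> {1..n} \<Longrightarrow> g' i \<in> w_star_slice (y i) (\<beta> i)\<rbrakk>
      \<Longrightarrow> norm ((\<Sum>i=1..n. l i *\<^sub>R g i) - (\<Sum>i=1..n. l i *\<^sub>R g' i)) \<le> \<epsilon>"
proof -
  from assms obtain n :: nat and T :: "nat \<Rightarrow> ('b \<Rightarrow>\<^sub>L real) set" and l where
    slices: "\<forall>i\<in>{1..n}. is_w_star_slice (T i)" and l: "\<forall>i\<in>{1..n}. 0 \<le> l i" "(\<Sum>i=1..n. l i) = 1"
    and diam: "diameter {\<Sum>i=1..n. l i *\<^sub>R g i | g. \<forall>i\<in>{1..n}. g i \<in> T i} < \<epsilon>"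
    unfolding dual_w_star_BSCSP_def by blast
  from slices have "\<forall>i\<in>{1..n}. \<exists>yb. norm (fst yb) = 1 \<and> 0 < snd yb \<and> T i = w_star_slice (fst yb) (snd yb)"
    by (fastforce simp: is_w_star_slice_def)
  then obtain yb where yb: "\<forall>i\<in>{1..n}. norm (fst (yb i)) = 1 \<and> 0 < snd (yb i) \<and>
      T i = w_star_slice (fst (yb i)) (snd (yb i))"
    by (rule bchoice[THEN exE])
  let ?D = "{\<Sum>i=1..n. l i *\<^sub>R g i | g. \<forall>i\<in>{1..n}. g i \<in> T i}"
  have "norm (\<Sum>i=1..n. l i *\<^sub>R g i) \<le> 1" if g: "\<forall>i\<in>{1..n}. g i \<in> T i" for g
  proof -
    have "norm (l i *\<^sub>R g i) \<le> l i" if i: "i \<in> {1..n}" for i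
    proof -
      have "norm (g i) \<le> 1" using g yb i by (auto simp: w_star_slice_def)
      then show ?thesis using l(1) i by (simp add: mult_left_le)
    qed
    then have "norm (\<Sum>i=1..n. l i *\<^sub>R g i) \<le> (\<Sum>i=1..n. l i)" by (rule sum_norm_le)
    with l(2) show ?thesis by simp
  qed
  then have bdd: "bounded ?D" by (intro boundedI[of _ 1]) auto
  show thesis
  proof (rule that[of n "\<lambda>i. fst (yb i)" "\<lambda>i. snd (yb i)" l])
    fix g g'
    assume "\<And>i. i \<in> {1..n} \<Longrightarrow> g i \<in> w_star_slice (fst (yb i)) (snd (yb i))"
      and "\<And>i. i \<in> {1..n} \<Longrightarrow> g' i \<in> w_star_slice (fst (yb i)) (snd (yb i))"
    then have "(\<Sum>i=1..n. l i *\<^sub>R g i) \<in> ?D" "(\<Sum>i=1..n. l i *\<^sub>R g' i) \<in> ?D"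
      using yb by blast+
    from diameter_bounded_bound[OF bdd this] diam
    show "norm ((\<Sum>i=1..n. l i *\<^sub>R g i) - (\<Sum>i=1..n. l i *\<^sub>R g' i)) \<le> \<epsilon>"
      by (simp add: dist_norm)
  qed (use yb l in auto)
qed

text \<open>Lowering \<open>\<alpha>\<close> shrinks the slice, so \<open>\<alpha>\<close> can be made as small as the diameter.\<close>

lemma w_star_BDP_witness:
  assumes "dual_w_star_BDP TYPE('a::real_normed_vector)" and "0 < \<epsilon>"
  obtains x0 :: "'a::real_normed_vector" and \<alpha> and f0
  where "norm x0 = 1" and "0 < \<alpha>" and "\<alpha> \<le> \<epsilon>" and "norm f0 \<le> 1"
    and "\<And>f. f \<in> w_star_slice x0 \<alpha> \<Longrightarrow> norm (f - f0) \<le> \<epsilon>"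
proof -
  from assms obtain x0 :: 'a and \<alpha>0
    where x0: "norm x0 = 1" and \<alpha>0: "0 < \<alpha>0" and diam: "diameter (w_star_slice x0 \<alpha>0) < \<epsilon>"
    unfolding dual_w_star_BDP_def is_w_star_slice_def by (metis mem_sphere_0)
  obtain f0 where f0: "norm f0 = 1" "blinfun_apply f0 x0 = norm x0"
    using norming_functional[of x0] x0 by (metis norm_zero zero_neq_one)
  have f0_slice: "f0 \<in> w_star_slice x0 \<alpha>0" using f0 x0 \<alpha>0 by (simp add: w_star_slice_def)
  have bdd: "bounded (w_star_slice x0 \<alpha>0)"
    by (rule bounded_subset[OF bounded_cball[of 0 1]]) (auto simp: w_star_slice_def)
  show thesis
  proof (rule that[of x0 "min \<alpha>0 \<epsilon>" f0])
    fix f assume "f \<in> w_star_slice x0 (min \<alpha>0 \<epsilon>)"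
    then have "f \<in> w_star_slice x0 \<alpha>0" by (auto simp: w_star_slice_def)
    from diameter_bounded_bound[OF bdd this f0_slice] diam
    show "norm (f - f0) \<le> \<epsilon>" by (simp add: dist_norm)
  qed (use x0 \<alpha>0 f0 \<open>0 < \<epsilon>\<close> in auto)
qed

theorem proposition3p2:
  assumes "dual_w_star_BDP TYPE('a::banach)"
    and "dual_w_star_BSCSP TYPE('b::banach)"
  shows "dual_w_star_BSCSP TYPE(('a, 'b) inj_tensor)"
  unfolding dual_w_star_BSCSP_def
proof (intro allI impI)
  fix \<epsilon> :: real assume "0 < \<epsilon>"
  \<comment> \<open>The two sums \<open>\<Sum> \<lambda>\<^sub>i F\<^sub>i\<close> differ by at most \<open>3 d\<close> each from a product, and the products by \<open>d\<close>
    from each other, which leaves \<open>7 d < \<epsilon>\<close>.\<close>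
  define d where "d = \<epsilon> / 8"
  have d: "0 < d" using \<open>0 < \<epsilon>\<close> by (simp add: d_def)
  obtain x0 :: 'a and \<alpha> f0 where x0: "norm x0 = 1" and \<alpha>: "0 < \<alpha>" "\<alpha> \<le> d" and f0: "norm f0 \<le> 1"
    and near: "\<And>f. f \<in> w_star_slice x0 \<alpha> \<Longrightarrow> norm (f - f0) \<le> d"
    using w_star_BDP_witness[OF assms(1) d] by metis
  obtain n :: nat and y :: "nat \<Rightarrow> 'b" and \<beta> l :: "nat \<Rightarrow> real"
    where y: "\<And>i. i \<in> {1..n} \<Longrightarrow> norm (y i) = 1 \<and> 0 < \<beta> i"
    and l: "\<And>i. i \<in> {1..n} \<Longrightarrow> 0 \<le> l i" "(\<Sum>i=1..n. l i) = 1"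
    and small: "\<And>g g'. \<lbrakk>\<And>i. i \<in> {1..n} \<Longrightarrow> g i \<in> w_star_slice (y i) (\<beta> i);
        \<And>i. i \<in> {1..n} \<Longrightarrow> g' i \<in> w_star_slice (y i) (\<beta> i)\<rbrakk>
      \<Longrightarrow> norm ((\<Sum>i=1..n. l i *\<^sub>R g i) - (\<Sum>i=1..n. l i *\<^sub>R g' i)) \<le> d"
    using w_star_BSCSP_witness[OF assms(2) d] by blast
  \<comment> \<open>\<open>\<beta> i\<close> puts the partial functionals into the given slices, \<open>d \<alpha> / 2\<close> makes the error \<open>2 \<eta> / \<alpha>\<close> at
    most \<open>d\<close>, and \<open>1 / 2\<close> makes the parameter of the slice less than one.\<close>
  define \<eta> where "\<eta> i = Min {\<beta> i, d * \<alpha> / 2, 1 / 2}" for i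
  have \<eta>: "0 < \<eta> i" "\<eta> i < 1" "\<eta> i \<le> \<beta> i" "2 * \<eta> i / \<alpha> \<le> d" if "i \<in> {1..n}" for i
    using y[OF that] d \<alpha>(1) by (auto simp: \<eta>_def field_simps)
  define S where "S i = w_star_slice (inj_embed (tensor x0 (y i))) (\<eta> i)" for i
  let ?C = "{\<Sum>i=1..n. l i *\<^sub>R F i | F. \<forall>i\<in>{1..n}. F i \<in> S i}"
  have slice: "is_w_star_slice (S i)" if i: "i \<in> {1..n}" for i
    unfolding is_w_star_slice_def S_def
    using \<eta>[OF i] inj_norm_tensor_unit[OF x0, of "y i"] y[OF i]
    by (intro exI[of _ "inj_embed (tensor x0 (y i))"] exI[of _ "\<eta> i"])
      (simp add: norm_inj_embed)
  have partial: "partial_functional G x0 \<in> w_star_slice (y i) (\<beta> i)"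
    if i: "i \<in> {1..n}" and G: "G \<in> S i" for i G
    using norm_partial_functional_le[of G x0] x0 G \<eta>(3)[OF i]
    by (simp add: S_def w_star_slice_def partial_functional_apply)
  have product: "\<bar>G (inj_embed t) - partial_functional G x0 (contract_left f0 t)\<bar>
      \<le> 3 * d * inj_norm t" if i: "i \<in> {1..n}" and G: "G \<in> S i" for i G t
  proof -
    have "\<bar>G (inj_embed t) - partial_functional G x0 (contract_left f0 t)\<bar>
        \<le> (d + \<alpha> + 2 * \<eta> i / \<alpha>) * inj_norm t"
      by (rule slice_functional_near_product[OF x0 _ f0 \<alpha>(1) near])
        (use y[OF i] G in \<open>auto simp: S_def\<close>)
    also have "\<dots> \<le> 3 * d * inj_norm t"
      using \<alpha>(2) \<eta>(4)[OF i] by (intro mult_right_mono inj_norm_nonneg) simp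
    finally show ?thesis .
  qed
  have combination: "\<bar>(\<Sum>i=1..n. l i *\<^sub>R F i) (inj_embed t)
        - (\<Sum>i=1..n. l i *\<^sub>R partial_functional (F i) x0) (contract_left f0 t)\<bar>
      \<le> 3 * d * inj_norm t" if F: "\<And>i. i \<in> {1..n} \<Longrightarrow> F i \<in> S i" for F t
  proof -
    have "(\<Sum>i=1..n. l i *\<^sub>R F i) (inj_embed t)
        - (\<Sum>i=1..n. l i *\<^sub>R partial_functional (F i) x0) (contract_left f0 t)
      = (\<Sum>i=1..n. l i * (F i (inj_embed t) - partial_functional (F i) x0 (contract_left f0 t)))"
      by (simp add: blinfun.sum_left blinfun.scaleR_left right_diff_distrib sum_subtractf)
    also have "\<bar>\<dots>\<bar> \<le> (\<Sum>i=1..n. l i * (3 * d * inj_norm t))"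
      using product[OF _ F] l(1)
      by (intro order_trans[OF sum_abs sum_mono]) (simp add: abs_mult mult_left_mono)
    also have "\<dots> = 3 * d * inj_norm t"
      using l(2) by (simp flip: sum_distrib_right)
    finally show ?thesis .
  qed
  have "norm (P - P') \<le> 7 * d" if PP': "P \<in> ?C" "P' \<in> ?C" for P P'
  proof -
    obtain F F' where P: "P = (\<Sum>i=1..n. l i *\<^sub>R F i)" and F: "\<And>i. i \<in> {1..n} \<Longrightarrow> F i \<in> S i"
      and P': "P' = (\<Sum>i=1..n. l i *\<^sub>R F' i)" and F': "\<And>i. i \<in> {1..n} \<Longrightarrow> F' i \<in> S i"
      using PP' by blast
    define G where "G = (\<Sum>i=1..n. l i *\<^sub>R partial_functional (F i) x0)"
    define G' where "G' = (\<Sum>i=1..n. l i *\<^sub>R partial_functional (F' i) x0)"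
    have GG': "norm (G - G') \<le> d"
      unfolding G_def G'_def using F F' by (intro small partial)
    show ?thesis
    proof (rule norm_inj_functional_le)
      fix t
      have "\<bar>(G - G') (contract_left f0 t)\<bar> \<le> norm (G - G') * norm (contract_left f0 t)"
        using norm_blinfun[of "G - G'"] by simp
      also have "\<dots> \<le> d * inj_norm t"
        using GG' norm_contract_left_le[OF f0, of t] d by (intro mult_mono) auto
      finally show "\<bar>(P - P') (inj_embed t)\<bar> \<le> 7 * d * inj_norm t"
        using combination[of F t, OF F] combination[of F' t, OF F']
        unfolding P P' G_def G'_def blinfun.diff_left by linarith
    qed (use d in simp)
  qed
  then have "diameter ?C \<le> 7 * d"
    using d by (intro diameter_le) auto
  also have "\<dots> < \<epsilon>" using \<open>0 < \<epsilon>\<close> by (simp add: d_def)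
  finally show "\<exists>n S l. (\<forall>i\<in>{1..n}. is_w_star_slice (S i)) \<and> (\<forall>i\<in>{1..n}. 0 \<le> l i) \<and>
      (\<Sum>i=1..n. l i) = 1 \<and>
      diameter {\<Sum>i=1..n. l i *\<^sub>R F i | F :: nat \<Rightarrow> ('a, 'b) inj_tensor \<Rightarrow>\<^sub>L real.
        \<forall>i\<in>{1..n}. F i \<in> S i} < \<epsilon>"
    using slice l by blast
qed

end
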